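(* Let $G$ be an infinite finitely generated group, let $\{X_n\}_{n\in\mathbb{N}}$ be an exhaustive sequence for $G$ that contains an amenable subsequence, and let $\mathcal{A}=\langle Q,\mathcal{N},f\rangle$ be a cellular automaton over $G$. Then: 1. If $\mathcal{A}$ is $(B,\{X_n\})$-surjective, then it is surjective. 2. If $\mathcal{A}$ is $(B,\{X_n\})$-injective, then it is preinjective. 3. If $\mathcal{A}$ is $(B,\{X_n\})$-injective, then it is $(B,\{X_n\})$-surjective.
   Context: A sequence $\{X_n\}_{n\in\mathbb{N}}$ of finite subsets of $G$ is exhaustive if $X_n\subseteq X_{n+1}$ for all $n$ and $\bigcup_n X_n=G$. For finite nonempty $E\subseteq G$ and $X\subseteq G$ put $X^{+E}=XE^{-1}=\{g\in G: gE\cap X\ne\emptyset\}$ and $\partial_E X=X^{+E}\setminus X$. An exhaustive sequence $\{X_n\}$ is amenable (a Følner sequence) if $\lim_{n\to\infty}|\partial_E X_n|/|X_n|=0$ for every finite nonempty $E\subseteq G$. A cellular automaton over $G$ is a triple $\mathcal{A}=\langle Q,\mathcal{N},f\rangle$ where $Q$ is a finite set with at least two elements, $\mathcal{N}\subseteq G$ is finite and nonempty, and $f:Q^{\mathcal{N}}\to Q$. For $c\in Q^G$, $g\in G$, $c^g(h)=c(gh)$. The global evolution function is $F_{\mathcal{A}}:Q^G\to Q^G$, $(F_{\mathcal{A}}(c))(g)=f\big((c^g)|_{\mathcal{N}}\big)$. Properties such as surjectivity are attributed to $\mathcal{A}$ when $F_{\mathcal{A}}$ has them. Two patterns $p_1,p_2\in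 Q^E$ with the same finite support $E\subseteq G$ are mutually erasable for $\mathcal{A}$ if $F_{\mathcal{A}}(c_1)=F_{\mathcal{A}}(c_2)$ for all $c_1,c_2\in Q^G$ with $c_1|_E=p_1$, $c_2|_E=p_2$ and $c_1|_{G\setminus E}=c_2|_{G\setminus E}$. $\mathcal{A}$ is preinjective if it has no two distinct mutually erasable patterns. The Besicovitch pseudodistance on $Q^G$ is $d_{B,\{X_n\}}(c_1,c_2)=\limsup_{n\to\infty}|\{x\in X_n:c_1(x)\ne c_2(x)\}|/|X_n|$. A map $F:Q^G\to Q^G$ is $(B,\{X_n\})$-surjective if for every $c\in Q^G$ there is $c'\in Q^G$ with $d_{B,\{X_n\}}(c,F(c'))=0$; it is $(B,\{X_n\})$-injective if $d_{B,\{X_n\}}(c_1,c_2)>0$ implies $d_{B,\{X_n\}}(F(c_1),F(c_2))>0$. *)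

theory Defs
  imports "HOL-Algebra.Generated_Groups" "HOL-Algebra.Coset" "HOL-Library.Extended_Real"
begin

definition finitely_generated :: "('g, 'm) monoid_scheme \<Rightarrow> bool" where
  "finitely_generated G \<longleftrightarrow> (\<exists>S. finite S \<and> S \<subseteq> carrier G \<and> generate G S = carrier G)"

subsection \<open>Exhaustive and amenable sequences\<close>

definition exhaustive_seq :: "('g, 'm) monoid_scheme \<Rightarrow> (nat \<Rightarrow> 'g set) \<Rightarrow> bool" where
  "exhaustive_seq G X \<longleftrightarrow>
     (\<forall>n. finite (X n)) \<and> (\<forall>n. X n \<subseteq> X (Suc n)) \<and> (\<Union>n. X n) = carrier G"

definition thickening :: "('g, 'm) monoid_scheme \<Rightarrow> 'g set \<Rightarrow> 'g set \<Rightarrow> 'g set" where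
  "thickening G E X = X <#>\<^bsub>G\<^esub> (set_inv\<^bsub>G\<^esub> E)"

lemma (in group) thickening_eq:
  assumes "E \<subseteq> carrier G" "X \<subseteq> carrier G"
  shows "thickening G E X = {g \<in> carrier G. (g <# E) \<inter> X \<noteq> {}}"
proof (intro equalityI subsetI)
  fix g assume "g \<in> thickening G E X"
  then obtain x e where xe: "x \<in> X" "e \<in> E" "g = x \<otimes> inv e"
    by (auto simp: thickening_def set_mult_def SET_INV_def)
  with assms have "g \<in> carrier G" "g \<otimes> e = x"
    by (auto simp: m_assoc subset_iff)
  with xe show "g \<in> {g \<in> carrier G. (g <# E) \<inter> X \<noteq> {}}"
    by (auto simp: l_coset_def)
next
  fix g assume "g \<in> {g \<in> carrier G. (g <# E) \<inter> X \<noteq> {}}"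
  then obtain e where e: "g \<in> carrier G" "e \<in> E" "g \<otimes> e \<in> X"
    by (auto simp: l_coset_def)
  with assms have "g = (g \<otimes> e) \<otimes> inv e"
    by (simp add: m_assoc subset_iff)
  with e show "g \<in> thickening G E X"
    unfolding thickening_def set_mult_def SET_INV_def by blast
qed

definition boundary :: "('g, 'm) monoid_scheme \<Rightarrow> 'g set \<Rightarrow> 'g set \<Rightarrow> 'g set" where
  "boundary G E X = thickening G E X - X"

text \<open>Finitely many initial members of an exhaustive sequence may be empty; the quotients
  below then take the value \<open>0\<close>, which affects neither limits nor upper limits.\<close>

definition amenable_seq :: "('g, 'm) monoid_scheme \<Rightarrow> (nat \<Rightarrow> 'g set) \<Rightarrow> bool" where
  "amenable_seq G X \<longleftrightarrow> exhaustive_seq G X \<and>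
     (\<forall>E. finite E \<and> E \<noteq> {} \<and> E \<subseteq> carrier G \<longrightarrow>
        (\<lambda>n. real (card (boundary G E (X n))) / real (card (X n))) \<longlonglongrightarrow> 0)"

definition contains_amenable_subseq :: "('g, 'm) monoid_scheme \<Rightarrow> (nat \<Rightarrow> 'g set) \<Rightarrow> bool" where
  "contains_amenable_subseq G X \<longleftrightarrow>
     (\<exists>r :: nat \<Rightarrow> nat. strict_mono r \<and> amenable_seq G (X \<circ> r))"

subsection \<open>Cellular automata\<close>

text \<open>Configurations and patterns are extensional functions, so that equality in HOL is
  equality as functions on \<open>carrier G\<close> or on the support.\<close>

abbreviation configs :: "('g, 'm) monoid_scheme \<Rightarrow> 'q set \<Rightarrow> ('g \<Rightarrow> 'q) set" where
  "configs G Q \<equiv> carrier G \<rightarrow>\<^sub>E Q"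

definition translate :: "('g, 'm) monoid_scheme \<Rightarrow> 'g \<Rightarrow> ('g \<Rightarrow> 'q) \<Rightarrow> 'g \<Rightarrow> 'q" where
  "translate G g c = (\<lambda>h\<in>carrier G. c (g \<otimes>\<^bsub>G\<^esub> h))"

locale cellular_automaton = group G
  for G :: "('g, 'm) monoid_scheme" (structure) +
  fixes Q :: "'q set" and N :: "'g set" and f :: "('g \<Rightarrow> 'q) \<Rightarrow> 'q"
  assumes finite_states: "finite Q" and two_states: "2 \<le> card Q"
    and finite_neighborhood: "finite N" and neighborhood_nonempty: "N \<noteq> {}"
    and neighborhood_subset: "N \<subseteq> carrier G"
    and local_rule: "f \<in> (N \<rightarrow>\<^sub>E Q) \<rightarrow> Q"

definition global_map ::
    "('g, 'm) monoid_scheme \<Rightarrow> 'g set \<Rightarrow> (('g \<Rightarrow> 'q) \<Rightarrow> 'q) \<Rightarrow> ('g \<Rightarrow> 'q) \<Rightarrow> 'g \<Rightarrow> 'q" where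
  "global_map G N f c = (\<lambda>g\<in>carrier G. f (restrict (translate G g c) N))"

lemma (in cellular_automaton) global_map_in_configs:
  assumes "c \<in> configs G Q"
  shows "global_map G N f c \<in> configs G Q"
proof -
  have "restrict (translate G g c) N \<in> N \<rightarrow>\<^sub>E Q" if "g \<in> carrier G" for g
    using that assms neighborhood_subset by (auto simp: translate_def PiE_iff)
  then have "f (restrict (translate G g c) N) \<in> Q" if "g \<in> carrier G" for g
    using that local_rule by (blast dest: funcset_mem)
  then show ?thesis
    by (auto simp: global_map_def)
qed

definition ca_surjective ::
    "('g, 'm) monoid_scheme \<Rightarrow> 'q set \<Rightarrow> 'g set \<Rightarrow> (('g \<Rightarrow> 'q) \<Rightarrow> 'q) \<Rightarrow> bool" where
  "ca_surjective G Q N f \<longleftrightarrow> global_map G N f ` configs G Q = configs G Q"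

definition mutually_erasable ::
    "('g, 'm) monoid_scheme \<Rightarrow> 'q set \<Rightarrow> 'g set \<Rightarrow> (('g \<Rightarrow> 'q) \<Rightarrow> 'q) \<Rightarrow> 'g set \<Rightarrow>
      ('g \<Rightarrow> 'q) \<Rightarrow> ('g \<Rightarrow> 'q) \<Rightarrow> bool" where
  "mutually_erasable G Q N f E p1 p2 \<longleftrightarrow>
     (\<forall>c1 \<in> configs G Q. \<forall>c2 \<in> configs G Q.
        restrict c1 E = p1 \<and> restrict c2 E = p2 \<and>
        restrict c1 (carrier G - E) = restrict c2 (carrier G - E) \<longrightarrow>
        global_map G N f c1 = global_map G N f c2)"

definition preinjective ::
    "('g, 'm) monoid_scheme \<Rightarrow> 'q set \<Rightarrow> 'g set \<Rightarrow> (('g \<Rightarrow> 'q) \<Rightarrow> 'q) \<Rightarrow> bool" where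
  "preinjective G Q N f \<longleftrightarrow>
     \<not> (\<exists>E p1 p2. finite E \<and> E \<subseteq> carrier G \<and> p1 \<in> E \<rightarrow>\<^sub>E Q \<and> p2 \<in> E \<rightarrow>\<^sub>E Q \<and>
          p1 \<noteq> p2 \<and> mutually_erasable G Q N f E p1 p2)"

subsection \<open>The Besicovitch pseudodistance\<close>

definition besicovitch_dist :: "(nat \<Rightarrow> 'g set) \<Rightarrow> ('g \<Rightarrow> 'q) \<Rightarrow> ('g \<Rightarrow> 'q) \<Rightarrow> ereal" where
  "besicovitch_dist X c1 c2 =
     limsup (\<lambda>n. ereal (real (card {x \<in> X n. c1 x \<noteq> c2 x}) / real (card (X n))))"

definition besicovitch_surjective ::
    "('g, 'm) monoid_scheme \<Rightarrow> 'q set \<Rightarrow> (nat \<Rightarrow> 'g set) \<Rightarrow> (('g \<Rightarrow> 'q) \<Rightarrow> 'g \<Rightarrow> 'q) \<Rightarrow> bool" where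
  "besicovitch_surjective G Q X F \<longleftrightarrow>
     (\<forall>c \<in> configs G Q. \<exists>c' \<in> configs G Q. besicovitch_dist X c (F c') = 0)"

definition besicovitch_injective ::
    "('g, 'm) monoid_scheme \<Rightarrow> 'q set \<Rightarrow> (nat \<Rightarrow> 'g set) \<Rightarrow> (('g \<Rightarrow> 'q) \<Rightarrow> 'g \<Rightarrow> 'q) \<Rightarrow> bool" where
  "besicovitch_injective G Q X F \<longleftrightarrow>
     (\<forall>c1 \<in> configs G Q. \<forall>c2 \<in> configs G Q.
        0 < besicovitch_dist X c1 c2 \<longrightarrow> 0 < besicovitch_dist X (F c1) (F c2))"

end

theory Submission
  imports Defs "HOL-Library.Disjoint_Sets" "HOL-Library.Infinite_Set"
begin

text \<open>
  Everything rests on one fact about a Foelner sequence: a maximal family of pairwise disjoint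
  translates \<open>m E\<close> of a finite set \<open>E\<close> has positive density, in the sense that the number of
  translates contained in the \<open>n\<close>-th set is at least a fixed proportion of its cardinality
  (\<open>saturated_packing_density\<close>). Two configurations that differ somewhere on each of these
  translates are therefore at positive Besicovitch distance
  (\<open>besicovitch_dist_pos_on_packing\<close>). Knowing this along the amenable subsequence suffices,
  because passing to a subsequence can only lower an upper limit.

  If the automaton is not surjective, a compactness argument yields an orphan: a finite pattern
  that occurs in no image of the global map, at any place. A configuration with a copy of the
  orphan on each translate of a packing differs from every image at a positive density of places,
  so the automaton is not Besicovitch-surjective either.

  If the automaton is not preinjective, take two distinct mutually erasable patterns and plant the
  first, respectively the second, on all translates of a packing. The two resulting configurations
  are at positive distance, yet they have the same image: near any given place only finitely many
  planted patterns matter, and these can be exchanged one after the other. So the automaton is not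
  Besicovitch-injective.

  Finally, Besicovitch-injectivity gives preinjectivity, and preinjectivity gives surjectivity by
  Myhill's half of the Garden of Eden theorem: if there were an orphan, then on a Foelner set \<open>Z\<close>
  each translate of a packing would lose at least one of its patterns, and for small boundary this
  loss makes the number of images smaller than the number of configurations that are constant
  outside \<open>Z\<close>. Two of the latter would share an image, against preinjectivity. A surjective map
  is of course Besicovitch-surjective, with distance zero attained by a true preimage.
\<close>

section \<open>Packings by translates of a finite set\<close>

lemma (in group) mem_l_coset_iff:
  assumes "m \<in> carrier G" "E \<subseteq> carrier G" "x \<in> carrier G"
  shows "x \<in> m <# E \<longleftrightarrow> inv m \<otimes> x \<in> E"
proof
  assume "x \<in> m <# E"
  then obtain e where "e \<in> E" "x = m \<otimes> e" by (auto simp: l_coset_def)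
  with assms show "inv m \<otimes> x \<in> E" by (auto simp: m_assoc[symmetric])
next
  assume "inv m \<otimes> x \<in> E"
  moreover have "x = m \<otimes> (inv m \<otimes> x)" using assms by (simp add: m_assoc[symmetric])
  ultimately show "x \<in> m <# E" unfolding l_coset_def by blast
qed

text \<open>The last condition is maximality: no further translate can be added to the family.\<close>

definition (in group) saturated_packing :: "'a set \<Rightarrow> 'a set \<Rightarrow> bool" where
  "saturated_packing E M \<longleftrightarrow> M \<subseteq> carrier G \<and> disjoint_family_on (\<lambda>m. m <# E) M \<and>
     (\<forall>g\<in>carrier G. \<exists>m\<in>M. (g <# E) \<inter> (m <# E) \<noteq> {})"

lemma (in group) ex_saturated_packing:
  assumes "E \<noteq> {}"
  obtains M where "saturated_packing E M"
proof -
  define P where "P = {M. M \<subseteq> carrier G \<and> disjoint_family_on (\<lambda>m. m <# E) M}"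
  have "\<exists>M\<in>P. \<forall>M'\<in>P. M \<subseteq> M' \<longrightarrow> M' = M"
  proof (rule subset_Zorn_nonempty)
    show "P \<noteq> {}" by (auto simp: P_def disjoint_family_on_def)
  next
    fix C assume C: "C \<noteq> {}" "subset.chain P C"
    have "\<exists>M\<in>C. a \<in> M \<and> b \<in> M" if "a \<in> \<Union>C" "b \<in> \<Union>C" for a b
      using that C unfolding subset.chain_def by blast
    moreover have "M \<in> P" if "M \<in> C" for M
      using that C unfolding subset.chain_def by blast
    ultimately show "\<Union>C \<in> P"
      unfolding P_def disjoint_family_on_def by (simp add: Union_least) meson
  qed
  then obtain M where M: "M \<in> P" and max: "\<And>M'. M' \<in> P \<Longrightarrow> M \<subseteq> M' \<Longrightarrow> M' = M"
    by blast
  have "\<exists>m\<in>M. (g <# E) \<inter> (m <# E) \<noteq> {}" if g: "g \<in> carrier G" for g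
  proof (cases "g \<in> M")
    case True
    then show ?thesis using \<open>E \<noteq> {}\<close> by (force simp: l_coset_def)
  next
    case False
    then have "insert g M \<notin> P" using max[of "insert g M"] by blast
    then show ?thesis using M g unfolding P_def disjoint_family_on_def by fast
  qed
  with M have "saturated_packing E M" by (simp add: P_def saturated_packing_def)
  then show ?thesis by (rule that)
qed

lemma (in group) finite_thickening:
  assumes "finite E" "finite X"
  shows "finite (thickening G E X)"
proof -
  have "thickening G E X = (\<lambda>(x, e). x \<otimes> inv e) ` (X \<times> E)"
    by (auto simp: thickening_def set_mult_def SET_INV_def)
  with assms show ?thesis by simp
qed

lemma (in group) finite_tiles_inside:
  assumes "M \<subseteq> carrier G" "finite X" "E \<noteq> {}" "E \<subseteq> carrier G"
  shows "finite {m \<in> M. m <# E \<subseteq> X}"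
proof -
  obtain e where e: "e \<in> E" using \<open>E \<noteq> {}\<close> by blast
  have "{m \<in> M. m <# E \<subseteq> X} \<subseteq> (\<lambda>x. x \<otimes> inv e) ` X"
  proof
    fix m assume m: "m \<in> {m \<in> M. m <# E \<subseteq> X}"
    with e have "m \<otimes> e \<in> X" by (auto simp: l_coset_def)
    moreover have "m = (m \<otimes> e) \<otimes> inv e" using m e assms by (auto simp: m_assoc subset_iff)
    ultimately show "m \<in> (\<lambda>x. x \<otimes> inv e) ` X" by blast
  qed
  then show ?thesis using \<open>finite X\<close> finite_surj by blast
qed

text \<open>
  By maximality each \<open>g\<close> in \<open>X\<close> can be written \<open>g = m d\<close> with \<open>m\<close> in the packing and \<open>d\<close> in
  \<open>E E\<^sup>-\<^sup>1\<close>. Either the translate \<open>m E\<close> lies inside \<open>X\<close>, or some \<open>m k\<close> with \<open>k \<in> E\<close> falls outside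
  \<open>X\<close>; in the second case \<open>g = (m k) (k\<^sup>-\<^sup>1 d)\<close> shows that \<open>m k\<close> lies in the boundary of \<open>X\<close> with
  respect to the set \<open>W\<close> of all \<open>k\<^sup>-\<^sup>1 d\<close>. Thus a translate inside \<open>X\<close> accounts for at most
  \<open>d = |E E\<^sup>-\<^sup>1|\<close> elements, and a boundary element for at most \<open>|W|\<close>.
\<close>

lemma (in group) saturated_packing_count:
  assumes E: "finite E" "E \<noteq> {}" "E \<subseteq> carrier G"
    and M: "saturated_packing E M"
  obtains d W where "0 < d" "finite W" "W \<noteq> {}" "W \<subseteq> carrier G"
    "\<forall>X. finite X \<and> X \<subseteq> carrier G \<longrightarrow>
       card X \<le> card {m \<in> M. m <# E \<subseteq> X} * d + card (boundary G W X) * card W"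
proof -
  have Mc: "M \<subseteq> carrier G" using M by (simp add: saturated_packing_def)
  define D where "D = (\<lambda>(a, b). b \<otimes> inv a) ` (E \<times> E)"
  define W where "W = (\<lambda>(k, d). inv k \<otimes> d) ` (E \<times> D)"
  have D: "finite D" "D \<noteq> {}" "D \<subseteq> carrier G" using E by (auto simp: D_def)
  have W: "finite W" "W \<noteq> {}" "W \<subseteq> carrier G" using E D by (auto simp: W_def)
  have count: "card X \<le> card {m \<in> M. m <# E \<subseteq> X} * card D + card (boundary G W X) * card W"
    if X: "finite X" "X \<subseteq> carrier G" for X
  proof -
    let ?T = "{m \<in> M. m <# E \<subseteq> X}"
    have "X \<subseteq> (\<lambda>(m, d). m \<otimes> d) ` (?T \<times> D) \<union> (\<lambda>(b, w). b \<otimes> w) ` (boundary G W X \<times> W)"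
    proof
      fix g assume gX: "g \<in> X"
      with X have g: "g \<in> carrier G" by blast
      obtain m a b where m: "m \<in> M" and ab: "a \<in> E" "b \<in> E" and eq: "g \<otimes> a = m \<otimes> b"
        using M g unfolding saturated_packing_def by (force simp: l_coset_def)
      have car: "m \<in> carrier G" "a \<in> carrier G" "b \<in> carrier G" using m ab E Mc by auto
      define d where "d = b \<otimes> inv a"
      have d: "d \<in> D" "d \<in> carrier G" using ab car by (auto simp: D_def d_def)
      have "g = (g \<otimes> a) \<otimes> inv a" using g car by (simp add: m_assoc)
      then have gd: "g = m \<otimes> d" using car unfolding eq d_def by (simp add: m_assoc)
      show "g \<in> (\<lambda>(m, d). m \<otimes> d) ` (?T \<times> D) \<union> (\<lambda>(b, w). b \<otimes> w) ` (boundary G W X \<times> W)"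
      proof (cases "m <# E \<subseteq> X")
        case True
        with m d gd show ?thesis by blast
      next
        case False
        then obtain k where k: "k \<in> E" "m \<otimes> k \<notin> X" by (auto simp: l_coset_def)
        with E have kc: "k \<in> carrier G" by blast
        define w where "w = inv k \<otimes> d"
        have w: "w \<in> W" using k d by (auto simp: W_def w_def)
        have "m \<otimes> k \<otimes> w = m \<otimes> (k \<otimes> inv k) \<otimes> d"
          using car kc d by (simp only: w_def m_assoc m_closed inv_closed)
        then have gw: "m \<otimes> k \<otimes> w = g" using car kc d gd by simp
        then have "m \<otimes> k \<in> thickening G W X"
          using W X w gX car kc by (auto simp: thickening_eq l_coset_def)
        with k gw w show ?thesis unfolding boundary_def by force
      qed
    qed
    moreover have "finite ?T" using finite_tiles_inside[OF Mc X(1) E(2,3)] .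
    moreover have "finite (boundary G W X)"
      using finite_thickening W X by (simp add: boundary_def)
    ultimately have "card X \<le> card ((\<lambda>(m, d). m \<otimes> d) ` (?T \<times> D) \<union>
        (\<lambda>(b, w). b \<otimes> w) ` (boundary G W X \<times> W))"
      using D W by (intro card_mono) auto
    also have "\<dots> \<le> card (?T \<times> D) + card (boundary G W X \<times> W)"
      using \<open>finite ?T\<close> \<open>finite (boundary G W X)\<close> D W
      by (intro order.trans[OF card_Un_le] add_mono card_image_le) auto
    finally show ?thesis by (simp add: card_cartesian_product)
  qed
  have "0 < card D" using D by (simp add: card_gt_0_iff)
  then show ?thesis by (rule that[OF _ W]) (use count in simp)
qed

lemma (in group) exhaustive_eventually_nonempty:
  assumes "exhaustive_seq G X"
  shows "\<forall>\<^sub>F n in sequentially. 0 < card (X n)"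
proof -
  obtain k where k: "\<one> \<in> X k" using assms unfolding exhaustive_seq_def by blast
  have "X k \<subseteq> X n" if "k \<le> n" for n
    using lift_Suc_mono_le[of X k n] assms that unfolding exhaustive_seq_def by blast
  moreover have "finite (X n)" for n using assms unfolding exhaustive_seq_def by blast
  ultimately have "0 < card (X n)" if "k \<le> n" for n
    using that k unfolding card_gt_0_iff by blast
  then show ?thesis by (auto simp: eventually_sequentially)
qed

lemma (in group) amenable_boundary_small:
  assumes "amenable_seq G X" "finite E" "E \<noteq> {}" "E \<subseteq> carrier G" "0 < \<epsilon>"
  shows "\<forall>\<^sub>F n in sequentially. 0 < card (X n) \<and>
           real (card (boundary G E (X n))) < \<epsilon> * real (card (X n))"
proof -
  have "(\<lambda>n. real (card (boundary G E (X n))) / real (card (X n))) \<longlonglongrightarrow> 0"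
    using assms unfolding amenable_seq_def by blast
  then have "\<forall>\<^sub>F n in sequentially. real (card (boundary G E (X n))) / real (card (X n)) < \<epsilon>"
    using \<open>0 < \<epsilon>\<close> by (rule order_tendstoD)
  moreover have "\<forall>\<^sub>F n in sequentially. 0 < card (X n)"
    using assms exhaustive_eventually_nonempty unfolding amenable_seq_def by blast
  ultimately show ?thesis by eventually_elim (simp add: divide_less_eq)
qed

lemma (in group) saturated_packing_density:
  assumes X: "amenable_seq G X"
    and E: "finite E" "E \<noteq> {}" "E \<subseteq> carrier G"
    and M: "saturated_packing E M"
  obtains \<delta> :: real where "0 < \<delta>"
    "\<forall>\<^sub>F n in sequentially. 0 < card (X n) \<and>
       \<delta> * real (card (X n)) \<le> real (card {m \<in> M. m <# E \<subseteq> X n})"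
proof -
  obtain d W where d: "0 < d" and W: "finite W" "W \<noteq> {}" "W \<subseteq> carrier G"
    and count: "\<forall>X. finite X \<and> X \<subseteq> carrier G \<longrightarrow>
       card X \<le> card {m \<in> M. m <# E \<subseteq> X} * d + card (boundary G W X) * card W"
    using saturated_packing_count[OF E M] by blast
  have w: "0 < card W" using W by (simp add: card_gt_0_iff)
  \<comment> \<open>With this bound on the boundary its contribution to the count is at most half of \<open>X n\<close>;
    the translates inside \<open>X n\<close> account for the other half.\<close>
  have "0 < 1 / (2 * real (card W))" using w by simp
  from amenable_boundary_small[OF X W this]
  have "\<forall>\<^sub>F n in sequentially. 0 < card (X n) \<and>
       1 / (2 * real d) * real (card (X n)) \<le> real (card {m \<in> M. m <# E \<subseteq> X n})"
  proof eventually_elim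
    case (elim n)
    have "finite (X n)" "X n \<subseteq> carrier G"
      using X unfolding amenable_seq_def exhaustive_seq_def by blast+
    with count have "real (card (X n)) \<le> real (card {m \<in> M. m <# E \<subseteq> X n}) * real d
            + real (card (boundary G W (X n))) * real (card W)"
      by (auto simp flip: of_nat_add of_nat_mult)
    moreover have "real (card (boundary G W (X n))) * real (card W) \<le> real (card (X n)) / 2"
      using elim w by (simp add: field_simps)
    ultimately have "real (card (X n)) \<le> real (card {m \<in> M. m <# E \<subseteq> X n}) * (2 * real d)"
      by linarith
    then show ?case using elim d by (simp add: divide_le_eq)
  qed
  then show ?thesis using that[of "1 / (2 * real d)"] d by simp
qed

section \<open>Planting a pattern on a packing\<close>

text \<open>
  A copy of \<open>p\<close> is written on each translate \<open>m E\<close>, and \<open>c\<close> is kept elsewhere. The choice operator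
  picks the translate in which \<open>x\<close> lies; it is unambiguous when the translates are disjoint.
\<close>

definition plant ::
    "('g, 'm) monoid_scheme \<Rightarrow> 'g set \<Rightarrow> 'g set \<Rightarrow> ('g \<Rightarrow> 'q) \<Rightarrow> ('g \<Rightarrow> 'q) \<Rightarrow> 'g \<Rightarrow> 'q" where
  "plant G M E p c = (\<lambda>x\<in>carrier G.
     if \<exists>m\<in>M. x \<in> m <#\<^bsub>G\<^esub> E
     then p (inv\<^bsub>G\<^esub> (SOME m. m \<in> M \<and> x \<in> m <#\<^bsub>G\<^esub> E) \<otimes>\<^bsub>G\<^esub> x)
     else c x)"

context group
begin

lemma plant_tile:
  assumes "M \<subseteq> carrier G" "E \<subseteq> carrier G" "disjoint_family_on (\<lambda>m. m <# E) M"
    and "m \<in> M" "e \<in> E"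
  shows "plant G M E p c (m \<otimes> e) = p e"
proof -
  have mem: "m \<otimes> e \<in> m <# E" using \<open>e \<in> E\<close> by (auto simp: l_coset_def)
  have "(SOME m'. m' \<in> M \<and> m \<otimes> e \<in> m' <# E) = m"
  proof (rule some_equality)
    show "m \<in> M \<and> m \<otimes> e \<in> m <# E" using mem \<open>m \<in> M\<close> by blast
    fix m' assume "m' \<in> M \<and> m \<otimes> e \<in> m' <# E"
    then show "m' = m" using assms(3) mem \<open>m \<in> M\<close> unfolding disjoint_family_on_def by blast
  qed
  moreover have "inv m \<otimes> (m \<otimes> e) = e" "m \<otimes> e \<in> carrier G"
    using assms by (auto simp: m_assoc[symmetric] subset_iff)
  ultimately show ?thesis using mem \<open>m \<in> M\<close> by (auto simp: plant_def)
qed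

lemma plant_off_tiles:
  assumes "x \<in> carrier G" "\<And>m. m \<in> M \<Longrightarrow> x \<notin> m <# E"
  shows "plant G M E p c x = c x"
  using assms by (auto simp: plant_def)

lemma plant_in_configs:
  assumes "M \<subseteq> carrier G" "E \<subseteq> carrier G" "disjoint_family_on (\<lambda>m. m <# E) M"
    and "p \<in> E \<rightarrow>\<^sub>E Q" "c \<in> configs G Q"
  shows "plant G M E p c \<in> configs G Q"
proof (rule PiE_I)
  fix x assume x: "x \<in> carrier G"
  show "plant G M E p c x \<in> Q"
  proof (cases "\<exists>m\<in>M. x \<in> m <# E")
    case True
    then obtain m e where "m \<in> M" "e \<in> E" "x = m \<otimes> e" by (auto simp: l_coset_def)
    then show ?thesis using plant_tile[OF assms(1-3), of m e p c] PiE_mem[OF assms(4), of e] by simp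
  next
    case False
    then have "plant G M E p c x = c x" by (intro plant_off_tiles x) auto
    then show ?thesis using PiE_mem[OF assms(5) x] by simp
  qed
qed (simp add: plant_def)

lemma translate_plant:
  assumes "M \<subseteq> carrier G" "E \<subseteq> carrier G" "disjoint_family_on (\<lambda>m. m <# E) M"
    and "p \<in> E \<rightarrow>\<^sub>E Q" "m \<in> M"
  shows "restrict (translate G m (plant G M E p c)) E = p"
proof
  fix x show "restrict (translate G m (plant G M E p c)) E x = p x"
    using assms plant_tile[OF assms(1-3,5)] by (cases "x \<in> E") (auto simp: translate_def)
qed

end

section \<open>Positive Besicovitch distance\<close>

text \<open>A lower bound along a subsequence is enough, since the distance is an upper limit.\<close>

lemma besicovitch_dist_pos:
  fixes \<delta> :: real
  assumes "strict_mono r" "0 < \<delta>"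
    and "\<forall>\<^sub>F n in sequentially. 0 < card (X (r n)) \<and>
           \<delta> * real (card (X (r n))) \<le> real (card {x \<in> X (r n). c1 x \<noteq> c2 x})"
  shows "0 < besicovitch_dist X c1 c2"
proof -
  let ?q = "\<lambda>n. ereal (real (card {x \<in> X n. c1 x \<noteq> c2 x}) / real (card (X n)))"
  have "\<forall>\<^sub>F n in sequentially. ereal \<delta> \<le> (?q \<circ> r) n"
    using assms(3) by eventually_elim (simp add: le_divide_eq)
  then have "ereal \<delta> \<le> limsup (?q \<circ> r)"
    by (rule le_Limsup[OF sequentially_bot])
  also have "\<dots> \<le> limsup ?q"
    by (rule limsup_subseq_mono[OF \<open>strict_mono r\<close>])
  finally show ?thesis
    using \<open>0 < \<delta>\<close> unfolding besicovitch_dist_def by (simp add: less_le_trans[of 0 "ereal \<delta>"])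
qed

lemma besicovitch_dist_self: "besicovitch_dist X c c = 0"
  by (simp add: besicovitch_dist_def zero_ereal_def[symmetric] Limsup_const)

text \<open>
  Places of disagreement chosen in different translates are different, so they are at least as
  numerous as the translates contained in \<open>X n\<close>.
\<close>

lemma (in group) besicovitch_dist_pos_on_packing:
  assumes r: "strict_mono r" and X: "amenable_seq G (X \<circ> r)"
    and E: "finite E" "E \<noteq> {}" "E \<subseteq> carrier G"
    and M: "saturated_packing E M"
    and diff: "\<And>m. m \<in> M \<Longrightarrow> \<exists>x\<in>m <# E. c1 x \<noteq> c2 x"
  shows "0 < besicovitch_dist X c1 c2"
proof -
  obtain \<delta> :: real where \<delta>: "0 < \<delta>" and dens: "\<forall>\<^sub>F n in sequentially. 0 < card ((X \<circ> r) n) \<and>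
       \<delta> * real (card ((X \<circ> r) n)) \<le> real (card {m \<in> M. m <# E \<subseteq> (X \<circ> r) n})"
    using saturated_packing_density[OF X E M] by blast
  obtain z where z: "\<And>m. m \<in> M \<Longrightarrow> z m \<in> m <# E \<and> c1 (z m) \<noteq> c2 (z m)"
    using diff by metis
  have inj: "inj_on z M"
  proof (rule inj_onI)
    fix a b assume "a \<in> M" "b \<in> M" "z a = z b"
    with z[of a] z[of b] M show "a = b"
      unfolding saturated_packing_def disjoint_family_on_def by fastforce
  qed
  have "card {m \<in> M. m <# E \<subseteq> X (r n)} \<le> card {x \<in> X (r n). c1 x \<noteq> c2 x}" for n
  proof (rule card_inj_on_le[of z])
    show "inj_on z {m \<in> M. m <# E \<subseteq> X (r n)}" using inj by (rule inj_on_subset) blast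
    show "z ` {m \<in> M. m <# E \<subseteq> X (r n)} \<subseteq> {x \<in> X (r n). c1 x \<noteq> c2 x}" using z by blast
    have "finite (X (r n))" using X unfolding amenable_seq_def exhaustive_seq_def by simp
    then show "finite {x \<in> X (r n). c1 x \<noteq> c2 x}" by simp
  qed
  then have "\<forall>\<^sub>F n in sequentially. 0 < card (X (r n)) \<and>
           \<delta> * real (card (X (r n))) \<le> real (card {x \<in> X (r n). c1 x \<noteq> c2 x})"
    using dens by (auto elim!: eventually_mono intro: order.trans)
  then show ?thesis by (rule besicovitch_dist_pos[OF r \<delta>])
qed

section \<open>Locality, equivariance and compactness\<close>

context cellular_automaton
begin

lemma states_nonempty: "Q \<noteq> {}"
  using two_states by (metis card.empty not_numeral_le_zero)

lemma global_map_local: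
  assumes "g \<in> carrier G" "\<And>x. x \<in> g <# N \<Longrightarrow> c x = c' x"
  shows "global_map G N f c g = global_map G N f c' g"
proof -
  have "restrict (translate G g c) N = restrict (translate G g c') N"
  proof (rule restrict_ext)
    fix n assume n: "n \<in> N"
    then have "g \<otimes> n \<in> g <# N" by (auto simp: l_coset_def)
    with n neighborhood_subset show "translate G g c n = translate G g c' n"
      using assms(2) by (auto simp: translate_def)
  qed
  with assms show ?thesis by (simp add: global_map_def)
qed

lemma translate_translate:
  assumes "g \<in> carrier G" "m \<in> carrier G"
  shows "translate G g (translate G m c) = translate G (m \<otimes> g) c"
  unfolding translate_def using assms by (intro restrict_ext) (simp add: m_assoc)

lemma translate_in_configs:
  assumes "c \<in> configs G Q" "m \<in> carrier G"
  shows "translate G m c \<in> configs G Q"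
  unfolding translate_def using assms by (auto simp: PiE_mem)

lemma global_map_translate:
  assumes "m \<in> carrier G"
  shows "global_map G N f (translate G m c) = translate G m (global_map G N f c)"
proof
  fix g show "global_map G N f (translate G m c) g = translate G m (global_map G N f c) g"
  proof (cases "g \<in> carrier G")
    case True
    then have "global_map G N f (translate G m c) g = f (restrict (translate G (m \<otimes> g) c) N)"
      by (simp add: global_map_def translate_translate assms)
    also have "\<dots> = global_map G N f c (m \<otimes> g)" using True assms by (simp add: global_map_def)
    finally show ?thesis using True by (simp add: translate_def)
  qed (simp add: global_map_def translate_def)
qed

lemma translate_cancel:
  assumes "translate G m c = translate G m c'" "m \<in> carrier G"
    and "c \<in> configs G Q" "c' \<in> configs G Q"
  shows "c = c'"
proof (rule PiE_ext[OF assms(3,4)])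
  fix x assume x: "x \<in> carrier G"
  then have "translate G m c (inv m \<otimes> x) = translate G m c' (inv m \<otimes> x)" using assms(1) by simp
  then show "c x = c' x" using x assms(2) by (simp add: translate_def m_assoc[symmetric])
qed

end

text \<open>
  Sequential compactness of \<open>Q\<close>-valued functions on a countable set. By the pigeonhole principle
  the index set can be shrunk successively, remaining infinite, so that from the \<open>k\<close>-th step on all
  surviving functions agree on \<open>A k\<close>; the limit reads off these common values.
\<close>

lemma finite_valued_cluster_point:
  fixes A :: "nat \<Rightarrow> 'a set" and c :: "nat \<Rightarrow> 'a \<Rightarrow> 'q"
  assumes A: "\<And>n. finite (A n)" "\<And>n. A n \<subseteq> A (Suc n)"
    and Q: "finite Q" "\<And>n x. x \<in> (\<Union>k. A k) \<Longrightarrow> c n x \<in> Q"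
  obtains d where "\<And>k. \<exists>\<^sub>\<infinity>n. \<forall>x\<in>A k. c n x = d x"
proof -
  have "\<exists>S. \<forall>k. (infinite (S k) \<and> (\<forall>n\<in>S k. \<forall>n'\<in>S k. \<forall>x\<in>A k. c n x = c n' x)) \<and>
               S (Suc k) \<subseteq> S k"
  proof -
    have step: "\<exists>S'. (infinite S' \<and> (\<forall>n\<in>S'. \<forall>n'\<in>S'. \<forall>x\<in>A k. c n x = c n' x)) \<and> S' \<subseteq> S"
      if S: "infinite S" for S :: "nat set" and k
    proof -
      let ?h = "\<lambda>n. restrict (c n) (A k)"
      have "c n x \<in> Q" if "x \<in> A k" for n x using Q(2) that by blast
      then have "?h ` S \<subseteq> A k \<rightarrow>\<^sub>E Q" by auto
      then have "finite (?h ` S)" by (rule finite_subset) (intro finite_PiE A(1) Q(1))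
      then obtain n0 where n0: "n0 \<in> S" "infinite {n \<in> S. ?h n = ?h n0}"
        using pigeonhole_infinite[OF S] by blast
      let ?S' = "{n \<in> S. ?h n = ?h n0}"
      have "\<forall>n\<in>?S'. \<forall>n'\<in>?S'. \<forall>x\<in>A k. c n x = c n' x"
      proof (intro ballI)
        fix n n' x assume "n \<in> ?S'" "n' \<in> ?S'" and x: "x \<in> A k"
        then have "?h n = ?h n'" by simp
        from fun_cong[OF this, of x] x show "c n x = c n' x" by simp
      qed
      moreover have "?S' \<subseteq> S" by blast
      ultimately show ?thesis using n0(2) by blast
    qed
    show ?thesis
    proof (rule dependent_nat_choice)
      show "\<exists>S. infinite S \<and> (\<forall>n\<in>S. \<forall>n'\<in>S. \<forall>x\<in>A 0. c n x = c n' x)"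
        using step[of UNIV 0] by auto
      fix S :: "nat set" and k assume "infinite S \<and> (\<forall>n\<in>S. \<forall>n'\<in>S. \<forall>x\<in>A k. c n x = c n' x)"
      then show "\<exists>S'. (infinite S' \<and> (\<forall>n\<in>S'. \<forall>n'\<in>S'. \<forall>x\<in>A (Suc k). c n x = c n' x)) \<and> S' \<subseteq> S"
        by (intro step) simp
    qed
  qed
  then obtain S where S': "\<forall>k. (infinite (S k) \<and>
      (\<forall>n\<in>S k. \<forall>n'\<in>S k. \<forall>x\<in>A k. c n x = c n' x)) \<and> S (Suc k) \<subseteq> S k" ..
  have S: "infinite (S k)" "S (Suc k) \<subseteq> S k"
    "n \<in> S k \<Longrightarrow> n' \<in> S k \<Longrightarrow> x \<in> A k \<Longrightarrow> c n x = c n' x" for k n n' x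
    using S'[THEN spec, of k] by blast+
  define pick where "pick k = (SOME n. n \<in> S k)" for k
  have pick: "pick k \<in> S k" for k
    using S(1)[of k] unfolding pick_def by (metis finite.emptyI some_in_eq)
  define d where "d x = c (pick (LEAST k. x \<in> A k)) x" for x
  have "c n x = d x" if "n \<in> S k" "x \<in> A k" for n k x
  proof -
    let ?l = "LEAST k. x \<in> A k"
    have l: "x \<in> A ?l" "?l \<le> k" using that(2) by (auto intro: LeastI Least_le)
    have "S k \<subseteq> S ?l" using S(2) l(2) by (rule lift_Suc_antimono_le)
    with that(1) have "n \<in> S ?l" by blast
    from S(3)[OF this pick l(1)] show ?thesis by (simp add: d_def)
  qed
  then have "S k \<subseteq> {n. \<forall>x\<in>A k. c n x = d x}" for k by blast
  then have "\<exists>\<^sub>\<infinity>n. \<forall>x\<in>A k. c n x = d x" for k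
    unfolding INFM_iff_infinite using S(1) infinite_super by blast
  then show ?thesis by (rule that)
qed

context cellular_automaton
begin

text \<open>
  The image of the global map is closed: preimages that are correct on larger and larger finite sets
  have a cluster point, and the value of the image at \<open>g\<close> depends only on the finite set \<open>g N\<close>.
\<close>

lemma in_range_if_finite_parts_in_range:
  assumes X: "exhaustive_seq G X" and c: "c \<in> configs G Q"
    and part: "\<And>n. \<exists>c'\<in>configs G Q. \<forall>x\<in>X n. global_map G N f c' x = c x"
  shows "c \<in> global_map G N f ` configs G Q"
proof -
  obtain b where b: "\<And>n. b n \<in> configs G Q" "\<And>n x. x \<in> X n \<Longrightarrow> global_map G N f (b n) x = c x"
    using part by metis
  have fin: "\<And>n. finite (X n)" and inc: "\<And>n. X n \<subseteq> X (Suc n)" and un: "(\<Union>n. X n) = carrier G"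
    using X unfolding exhaustive_seq_def by blast+
  have mono: "X i \<subseteq> X j" if "i \<le> j" for i j
    using lift_Suc_mono_le[of X, OF inc that] .
  have "b n x \<in> Q" if "x \<in> (\<Union>k. X k)" for n x using b(1)[of n] that un by auto
  then obtain d where d: "\<And>k. \<exists>\<^sub>\<infinity>n. \<forall>x\<in>X k. b n x = d x"
    using finite_valued_cluster_point[of X, OF fin inc finite_states, of b] by blast
  have dQ: "restrict d (carrier G) \<in> configs G Q"
  proof (rule PiE_I)
    fix x assume x: "x \<in> carrier G"
    then obtain k where "x \<in> X k" using un by blast
    with d[of k] obtain n where "b n x = d x" by (auto dest: INFM_EX)
    then show "restrict d (carrier G) x \<in> Q" using x b(1)[of n] by (metis PiE_mem restrict_apply')
  qed auto
  have "global_map G N f (restrict d (carrier G)) = c"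
  proof (rule PiE_ext[OF global_map_in_configs[OF dQ] c])
    fix g assume g: "g \<in> carrier G"
    have gN: "insert g (g <# N) \<subseteq> (\<Union>n. X n)"
      using g neighborhood_subset by (auto simp: un l_coset_def)
    have "subset.chain UNIV (range X)"
      unfolding subset_chain_def using mono nat_le_linear by blast
    moreover have "finite (insert g (g <# N))"
      using finite_neighborhood by (simp add: l_coset_def)
    ultimately obtain k where k: "insert g (g <# N) \<subseteq> X k"
      using finite_subset_Union_chain[OF _ gN, of UNIV] by blast
    obtain n where n: "n \<ge> k" "\<And>x. x \<in> X k \<Longrightarrow> b n x = d x"
      using d[of k] unfolding INFM_nat_le by blast
    have "global_map G N f (restrict d (carrier G)) g = global_map G N f (b n) g"
      using g k n gN un by (intro global_map_local) auto
    also have "\<dots> = c g" using b(2) k mono[OF n(1)] by blast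
    finally show "global_map G N f (restrict d (carrier G)) g = c g" .
  qed
  with dQ show ?thesis by blast
qed

definition orphan :: "'g set \<Rightarrow> ('g \<Rightarrow> 'q) \<Rightarrow> bool" where
  "orphan E p \<longleftrightarrow> p \<in> E \<rightarrow>\<^sub>E Q \<and>
     (\<forall>c\<in>configs G Q. \<forall>m\<in>carrier G. restrict (translate G m (global_map G N f c)) E \<noteq> p)"

text \<open>
  A configuration outside the closed image is already excluded by one of its finite restrictions.
  By equivariance this restriction cannot occur in an image at any other place either.
\<close>

lemma ex_orphan:
  assumes X: "exhaustive_seq G X" and ns: "\<not> ca_surjective G Q N f"
  obtains E p where "finite E" "E \<noteq> {}" "E \<subseteq> carrier G" "orphan E p"
proof -
  obtain c where c: "c \<in> configs G Q" "c \<notin> global_map G N f ` configs G Q"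
    using ns global_map_in_configs unfolding ca_surjective_def by blast
  then have "\<not> (\<forall>n. \<exists>c'\<in>configs G Q. \<forall>x\<in>X n. global_map G N f c' x = c x)"
    using in_range_if_finite_parts_in_range[OF X c(1)] by blast
  then obtain n where n: "\<And>c'. c' \<in> configs G Q \<Longrightarrow> \<exists>x\<in>X n. global_map G N f c' x \<noteq> c x"
    by blast
  have Xn: "finite (X n)" "X n \<subseteq> carrier G" using X unfolding exhaustive_seq_def by blast+
  have "restrict c (X n) \<in> X n \<rightarrow>\<^sub>E Q" using c Xn by auto
  moreover have "restrict (translate G m (global_map G N f b)) (X n) \<noteq> restrict c (X n)"
    if b: "b \<in> configs G Q" and m: "m \<in> carrier G" for b m
  proof
    assume eq: "restrict (translate G m (global_map G N f b)) (X n) = restrict c (X n)"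
    obtain x where "x \<in> X n" "global_map G N f (translate G m b) x \<noteq> c x"
      using n[OF translate_in_configs[OF b m]] by blast
    then show False using fun_cong[OF eq, of x] by (simp add: global_map_translate[OF m])
  qed
  ultimately have "orphan (X n) (restrict c (X n))" unfolding orphan_def by blast
  moreover have "X n \<noteq> {}" using n[OF c(1)] by blast
  ultimately show ?thesis using that Xn by blast
qed

section \<open>Besicovitch surjectivity implies surjectivity\<close>

theorem besicovitch_surjective_imp_surjective:
  assumes r: "strict_mono r" and X: "amenable_seq G (X \<circ> r)"
    and surj: "besicovitch_surjective G Q X (global_map G N f)"
  shows "ca_surjective G Q N f"
proof (rule ccontr)
  assume "\<not> ca_surjective G Q N f"
  moreover have "exhaustive_seq G (X \<circ> r)" using X unfolding amenable_seq_def by blast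
  ultimately obtain E p where E: "finite E" "E \<noteq> {}" "E \<subseteq> carrier G" and "orphan E p"
    using ex_orphan by blast
  then have p: "p \<in> E \<rightarrow>\<^sub>E Q" and orphan: "\<And>c m. c \<in> configs G Q \<Longrightarrow> m \<in> carrier G \<Longrightarrow>
       restrict (translate G m (global_map G N f c)) E \<noteq> p"
    by (auto simp: orphan_def)
  obtain M where sat: "saturated_packing E M" using ex_saturated_packing[OF E(2)] .
  then have M: "M \<subseteq> carrier G" "disjoint_family_on (\<lambda>m. m <# E) M"
    by (simp_all add: saturated_packing_def)
  obtain q where "q \<in> Q" using states_nonempty by blast
  define c where "c = plant G M E p (\<lambda>x\<in>carrier G. q)"
  have c: "c \<in> configs G Q"
    unfolding c_def using \<open>q \<in> Q\<close> by (intro plant_in_configs M E p) auto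
  then obtain c' where c': "c' \<in> configs G Q" "besicovitch_dist X c (global_map G N f c') = 0"
    using surj unfolding besicovitch_surjective_def by blast
  have "0 < besicovitch_dist X c (global_map G N f c')"
  proof (rule besicovitch_dist_pos_on_packing[OF r X E sat])
    fix m assume m: "m \<in> M"
    then have mc: "m \<in> carrier G" using M by blast
    have "restrict (translate G m (global_map G N f c')) E \<noteq> restrict (translate G m c) E"
      using orphan[OF c'(1) mc] translate_plant[OF M(1) E(3) M(2) p m] by (simp add: c_def)
    then obtain e where e: "e \<in> E" "translate G m (global_map G N f c') e \<noteq> translate G m c e"
      by (metis restrict_ext)
    moreover have "e \<in> carrier G" using e(1) E(3) by blast
    ultimately have "c (m \<otimes> e) \<noteq> global_map G N f c' (m \<otimes> e)" by (simp add: translate_def)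
    with e(1) show "\<exists>x\<in>m <# E. c x \<noteq> global_map G N f c' x" by (auto simp: l_coset_def)
  qed
  with c' show False by simp
qed

section \<open>Besicovitch injectivity implies preinjectivity\<close>

lemma mutually_erasable_translate:
  assumes er: "mutually_erasable G Q N f E p1 p2" and m: "m \<in> carrier G" and E: "E \<subseteq> carrier G"
    and c: "c1 \<in> configs G Q" "c2 \<in> configs G Q"
    and p: "restrict (translate G m c1) E = p1" "restrict (translate G m c2) E = p2"
    and off: "\<And>x. x \<in> carrier G \<Longrightarrow> x \<notin> m <# E \<Longrightarrow> c1 x = c2 x"
  shows "global_map G N f c1 = global_map G N f c2"
proof -
  have "translate G m c1 x = translate G m c2 x" if x: "x \<in> carrier G - E" for x
  proof -
    have "inv m \<otimes> (m \<otimes> x) = x" using x m by (simp add: m_assoc[symmetric])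
    then have "m \<otimes> x \<notin> m <# E" using mem_l_coset_iff[OF m E, of "m \<otimes> x"] x m by simp
    then show ?thesis using off[of "m \<otimes> x"] x m by (simp add: translate_def)
  qed
  then have "restrict (translate G m c1) (carrier G - E) = restrict (translate G m c2) (carrier G - E)"
    by (auto simp: restrict_def fun_eq_iff)
  then have "global_map G N f (translate G m c1) = global_map G N f (translate G m c2)"
    using er p translate_in_configs[OF _ m] c unfolding mutually_erasable_def by blast
  then show ?thesis
    using translate_cancel[OF _ m global_map_in_configs global_map_in_configs] c
    by (simp add: global_map_translate[OF m])
qed

text \<open>
  Mutual erasability allows for a single exchange, whereas here infinitely many take place. Let
  \<open>b S\<close> be the configuration in which only the copies at \<open>m \<in> S\<close> have been exchanged. For finite \<open>S\<close>
  the image is unchanged, by induction; and the image of \<open>b M\<close> at \<open>g\<close> is that of \<open>b S\<close> for the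
  finite set \<open>S\<close> of translates that meet \<open>g N\<close>.
\<close>

lemma global_map_plant_erasable:
  assumes er: "mutually_erasable G Q N f E p1 p2"
    and E: "finite E" "E \<subseteq> carrier G" and p: "p1 \<in> E \<rightarrow>\<^sub>E Q" "p2 \<in> E \<rightarrow>\<^sub>E Q"
    and M: "M \<subseteq> carrier G" "disjoint_family_on (\<lambda>m. m <# E) M" and c: "c \<in> configs G Q"
  shows "global_map G N f (plant G M E p1 c) = global_map G N f (plant G M E p2 c)"
proof -
  let ?c1 = "plant G M E p1 c"
  define b where "b S = plant G S E p2 ?c1" for S
  have c1: "?c1 \<in> configs G Q" by (intro plant_in_configs M E p c)
  have sub: "S \<subseteq> carrier G" "disjoint_family_on (\<lambda>m. m <# E) S" if "S \<subseteq> M" for S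
    using that M disjoint_family_on_mono by blast+
  have bQ: "b S \<in> configs G Q" if "S \<subseteq> M" for S
    unfolding b_def using sub[OF that] by (intro plant_in_configs E p c1)
  have b_eq: "b S x = b S' x"
    if "S \<subseteq> M" "S' \<subseteq> M" "x \<in> carrier G" "\<And>m. m \<in> M \<Longrightarrow> x \<in> m <# E \<Longrightarrow> m \<in> S \<longleftrightarrow> m \<in> S'" for S S' x
  proof (cases "\<exists>m\<in>S. x \<in> m <# E")
    case True
    then obtain m where m: "m \<in> S" "x \<in> m <# E" by blast
    then obtain e where e: "e \<in> E" "x = m \<otimes> e" by (auto simp: l_coset_def)
    have "m \<in> S'" using m that by blast
    then show ?thesis
      using plant_tile[OF sub(1)[OF that(1)] E(2) sub(2)[OF that(1)] m(1) e(1), of p2 ?c1]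
        plant_tile[OF sub(1)[OF that(2)] E(2) sub(2)[OF that(2)] _ e(1), of m p2 ?c1] e
      by (simp add: b_def)
  next
    case False
    then have "\<not> (\<exists>m\<in>S'. x \<in> m <# E)" using that by blast
    with False show ?thesis using plant_off_tiles[OF that(3)] by (metis b_def)
  qed
  have fin: "global_map G N f (b S) = global_map G N f ?c1" if "finite S" "S \<subseteq> M" for S
    using that
  proof (induction S)
    case empty
    have "b {} = ?c1"
      by (rule PiE_ext[OF bQ c1]) (auto simp: b_def intro!: plant_off_tiles)
    then show ?case by simp
  next
    case (insert m S)
    have m: "m \<in> carrier G" "m \<in> M" using insert M by auto
    have off: "(m <# E) \<inter> (m' <# E) = {}" if "m' \<in> S" for m'
      using insert.hyps insert.prems that m by (intro disjoint_family_onD[OF M(2)]) auto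
    have at: "b S (m \<otimes> e) = p1 e" if e: "e \<in> E" for e
    proof -
      have "m \<otimes> e \<in> m <# E" using e by (auto simp: l_coset_def)
      then have "b S (m \<otimes> e) = ?c1 (m \<otimes> e)"
        unfolding b_def using off m E e by (intro plant_off_tiles) auto
      also have "\<dots> = p1 e" using plant_tile[OF M(1) E(2) M(2) m(2) e] .
      finally show ?thesis .
    qed
    have "global_map G N f (b S) = global_map G N f (b (insert m S))"
    proof (rule mutually_erasable_translate[OF er m(1) E(2)])
      show "b S \<in> configs G Q" "b (insert m S) \<in> configs G Q" using bQ insert by auto
      show "restrict (translate G m (b S)) E = p1"
      proof
        fix x show "restrict (translate G m (b S)) E x = p1 x"
          using at[of x] E p by (cases "x \<in> E") (auto simp: translate_def)
      qed
      show "restrict (translate G m (b (insert m S))) E = p2"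
        unfolding b_def
        by (rule translate_plant[OF sub(1)[OF insert.prems] E(2) sub(2)[OF insert.prems] p(2)]) simp
    next
      fix x assume "x \<in> carrier G" "x \<notin> m <# E"
      then show "b S x = b (insert m S) x" using insert.prems by (intro b_eq) auto
    qed
    with insert show ?case by simp
  qed
  have "b M = plant G M E p2 c"
    by (auto simp: b_def plant_def fun_eq_iff)
  moreover have "global_map G N f (b M) = global_map G N f ?c1"
  proof (rule PiE_ext[OF global_map_in_configs global_map_in_configs])
    fix g assume g: "g \<in> carrier G"
    define S where "S = {m \<in> M. (m <# E) \<inter> (g <# N) \<noteq> {}}"
    have gN: "g <# N \<subseteq> carrier G" using g neighborhood_subset by (auto simp: l_coset_def)
    have "S \<subseteq> thickening G E (g <# N)"
      using M gN unfolding S_def thickening_eq[OF E(2) gN] by blast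
    moreover have "finite (thickening G E (g <# N))"
      using E finite_neighborhood by (intro finite_thickening) (auto simp: l_coset_def)
    ultimately have S: "finite S" "S \<subseteq> M" using finite_subset by (auto simp: S_def)
    have "global_map G N f (b M) g = global_map G N f (b S) g"
      using g gN S by (intro global_map_local b_eq) (auto simp: S_def)
    then show "global_map G N f (b M) g = global_map G N f ?c1 g" using fin[OF S] by simp
  qed (use bQ c1 in auto)
  ultimately show ?thesis by simp
qed

theorem besicovitch_injective_imp_preinjective:
  assumes r: "strict_mono r" and X: "amenable_seq G (X \<circ> r)"
    and inj: "besicovitch_injective G Q X (global_map G N f)"
  shows "preinjective G Q N f"
proof (rule ccontr)
  assume "\<not> preinjective G Q N f"
  then obtain E p1 p2 where E: "finite E" "E \<subseteq> carrier G"
    and p: "p1 \<in> E \<rightarrow>\<^sub>E Q" "p2 \<in> E \<rightarrow>\<^sub>E Q" "p1 \<noteq> p2"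
    and er: "mutually_erasable G Q N f E p1 p2"
    unfolding preinjective_def by blast
  obtain e where e: "e \<in> E" "p1 e \<noteq> p2 e" using p by (meson PiE_ext)
  obtain M where sat: "saturated_packing E M" using ex_saturated_packing[of E] e by blast
  then have M: "M \<subseteq> carrier G" "disjoint_family_on (\<lambda>m. m <# E) M"
    by (simp_all add: saturated_packing_def)
  obtain q where "q \<in> Q" using states_nonempty by blast
  define c where "c = (\<lambda>x\<in>carrier G. q)"
  have c: "c \<in> configs G Q" using \<open>q \<in> Q\<close> by (auto simp: c_def)
  have "0 < besicovitch_dist X (plant G M E p1 c) (plant G M E p2 c)"
  proof (rule besicovitch_dist_pos_on_packing[OF r X E(1) _ E(2) sat])
    fix m assume m: "m \<in> M"
    have "plant G M E p1 c (m \<otimes> e) \<noteq> plant G M E p2 c (m \<otimes> e)"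
      using e(2) by (simp only: plant_tile[OF M(1) E(2) M(2) m e(1)] not_False_eq_True)
    then show "\<exists>x\<in>m <# E. plant G M E p1 c x \<noteq> plant G M E p2 c x"
      using e(1) by (auto simp: l_coset_def)
  qed (use e in auto)
  moreover have "plant G M E p1 c \<in> configs G Q" "plant G M E p2 c \<in> configs G Q"
    by (intro plant_in_configs M E p c)+
  ultimately have "0 < besicovitch_dist X (global_map G N f (plant G M E p1 c))
      (global_map G N f (plant G M E p2 c))"
    using inj unfolding besicovitch_injective_def by blast
  then show False
    by (simp add: global_map_plant_erasable[OF er E p(1,2) M c] besicovitch_dist_self)
qed

end

section \<open>Myhill's theorem by counting\<close>

text \<open>
  A function on \<open>Y\<close> is determined by its restrictions to the disjoint sets \<open>A m\<close>, each of which may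
  take all but one of \<open>|Q|\<^sup>e\<close> values, and by its restriction to the rest of \<open>Y\<close>.
\<close>

lemma card_functions_avoiding_patterns:
  assumes fin: "finite Y" "finite Q" "finite T"
    and A: "\<And>m. m \<in> T \<Longrightarrow> A m \<subseteq> Y" "disjoint_family_on A T" "\<And>m. m \<in> T \<Longrightarrow> card (A m) = e"
    and w: "\<And>m. m \<in> T \<Longrightarrow> w m \<in> A m \<rightarrow>\<^sub>E Q"
  shows "card {u \<in> Y \<rightarrow>\<^sub>E Q. \<forall>m\<in>T. restrict u (A m) \<noteq> w m}
           \<le> (card Q ^ e - 1) ^ card T * card Q ^ (card Y - card T * e)"
    and "card T * e \<le> card Y"
proof -
  let ?U = "\<Union>m\<in>T. A m"
  let ?B = "{u \<in> Y \<rightarrow>\<^sub>E Q. \<forall>m\<in>T. restrict u (A m) \<noteq> w m}"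
  let ?P = "PiE T (\<lambda>m. (A m \<rightarrow>\<^sub>E Q) - {w m}) \<times> ((Y - ?U) \<rightarrow>\<^sub>E Q)"
  let ?h = "\<lambda>u. (\<lambda>m\<in>T. restrict u (A m), restrict u (Y - ?U))"
  have finA: "finite (A m)" if "m \<in> T" for m using A(1)[OF that] fin(1) finite_subset by blast
  have cU: "card ?U = card T * e"
    using A finA fin by (subst card_UN_disjoint') auto
  have UY: "?U \<subseteq> Y" using A by blast
  then show "card T * e \<le> card Y" using cU card_mono[OF fin(1)] by metis
  have "inj_on ?h ?B"
  proof (rule inj_onI)
    fix u v assume u: "u \<in> ?B" and v: "v \<in> ?B" and eq: "?h u = ?h v"
    have e1: "(\<lambda>m\<in>T. restrict u (A m)) = (\<lambda>m\<in>T. restrict v (A m))"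
      and e2: "restrict u (Y - ?U) = restrict v (Y - ?U)" using eq by simp_all
    show "u = v"
    proof (rule PiE_ext[of u Y "\<lambda>_. Q" v])
      fix x assume x: "x \<in> Y"
      show "u x = v x"
      proof (cases "x \<in> ?U")
        case True
        then obtain m where m: "m \<in> T" "x \<in> A m" by blast
        have "restrict u (A m) = restrict v (A m)" using fun_cong[OF e1, of m] m by simp
        from fun_cong[OF this, of x] m show ?thesis by simp
      next
        case False
        then show ?thesis using fun_cong[OF e2, of x] x by simp
      qed
    qed (use u v in auto)
  qed
  moreover have "?h ` ?B \<subseteq> ?P"
  proof
    fix z assume "z \<in> ?h ` ?B"
    then obtain u where u: "u \<in> Y \<rightarrow>\<^sub>E Q" "\<And>m. m \<in> T \<Longrightarrow> restrict u (A m) \<noteq> w m" "z = ?h u"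
      by blast
    have uQ: "u x \<in> Q" if "x \<in> Y" for x using u(1) that by blast
    then have "restrict u (A m) \<in> A m \<rightarrow>\<^sub>E Q" if "m \<in> T" for m using A(1)[OF that] by auto
    then show "z \<in> ?P" using u(2) uQ unfolding u(3) by auto
  qed
  moreover have "finite ?P"
    using fin finA by (intro finite_cartesian_product finite_PiE finite_Diff) auto
  ultimately have "card ?B \<le> card ?P" by (rule card_inj_on_le)
  also have "card ?P = (\<Prod>m\<in>T. card ((A m \<rightarrow>\<^sub>E Q) - {w m})) * card Q ^ card (Y - ?U)"
    using fin by (simp add: card_cartesian_product card_PiE)
  also have "(\<Prod>m\<in>T. card ((A m \<rightarrow>\<^sub>E Q) - {w m})) = (\<Prod>m\<in>T. card Q ^ e - 1)"
  proof (rule prod.cong[OF refl])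
    fix m assume m: "m \<in> T"
    then have "card (A m \<rightarrow>\<^sub>E Q) = card Q ^ e"
      using A(3) finA by (simp add: card_PiE)
    then show "card ((A m \<rightarrow>\<^sub>E Q) - {w m}) = card Q ^ e - 1"
      using w[OF m] by simp
  qed
  also have "(\<Prod>m\<in>T. card Q ^ e - 1) = (card Q ^ e - 1) ^ card T" by simp
  also have "card (Y - ?U) = card Y - card T * e"
    using cU UY fin by (metis card_Diff_subset finite_subset)
  finally show "card ?B \<le> (card Q ^ e - 1) ^ card T * card Q ^ (card Y - card T * e)" .
qed

text \<open>
  The left-hand side equals \<open>q\<^sup>t k\<^sup>y\<close> with \<open>q = 1 - k\<^sup>-\<^sup>e < 1\<close>. If \<open>s\<close> is such that \<open>q\<^sup>s < 1/k\<close>, then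
  \<open>s\<close> forbidden patterns outweigh the freedom of choice at one of the \<open>b\<close> additional places; the
  strict inequality \<open>s * b < t\<close> leaves one factor \<open>q\<close> to spare.
\<close>

lemma avoiding_bound_lt:
  fixes k e :: nat
  assumes k: "2 \<le> k"
  obtains s where "\<forall>t b x y. s * b < t \<and> y \<le> x + b \<and> t * e \<le> y \<longrightarrow>
      (k ^ e - 1) ^ t * k ^ (y - t * e) < k ^ x"
proof -
  define q :: real where "q = (real k ^ e - 1) / real k ^ e"
  have ke: "1 \<le> real k ^ e" using k by simp
  have q: "0 \<le> q" "q < 1" using ke by (auto simp: q_def divide_simps)
  obtain s where s: "q ^ s < 1 / real k"
    using real_arch_pow_inv[of "1 / real k" q] q k by auto
  have "(k ^ e - 1) ^ t * k ^ (y - t * e) < k ^ x"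
    if t: "s * b < t" and y: "y \<le> x + b" and te: "t * e \<le> y" for t b x y
  proof -
    have "real (k ^ e - 1) = q * real k ^ e" using ke k by (simp add: q_def of_nat_diff)
    then have "real ((k ^ e - 1) ^ t * k ^ (y - t * e)) = q ^ t * (real k ^ (t * e) * real k ^ (y - t * e))"
      by (simp add: power_mult_distrib mult.commute[of t e] power_mult)
    also have "\<dots> = q ^ t * real k ^ y" using te by (simp flip: power_add)
    also have "\<dots> \<le> q ^ (s * b + 1) * real k ^ (x + b)"
      using q k t y by (intro mult_mono power_decreasing power_increasing) auto
    also have "\<dots> = q * (q ^ s * real k) ^ b * real k ^ x"
      by (simp add: power_add power_mult power_mult_distrib)
    also have "\<dots> \<le> q * 1 * real k ^ x"
      using q s k by (intro mult_mono power_le_one) (auto simp: field_simps)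
    also have "\<dots> < real k ^ x" using q k by simp
    finally show ?thesis by (metis of_nat_less_iff of_nat_power)
  qed
  then show ?thesis using that by blast
qed

context cellular_automaton
begin

text \<open>
  Preinjectivity speaks of patterns, but amounts to injectivity on pairs of configurations that
  differ on a finite set \<open>X\<close> only. The restrictions of \<open>c1\<close> and \<open>c2\<close> to \<open>X\<close> itself need not be mutually
  erasable, because the images near \<open>X\<close> also depend on the surroundings. They become so on the set
  \<open>E\<close>, which contains every neighbourhood \<open>g N\<close> that meets \<open>X\<close>.
\<close>

lemma preinjective_finite_difference:
  assumes pre: "preinjective G Q N f" and c: "c1 \<in> configs G Q" "c2 \<in> configs G Q"
    and eq: "global_map G N f c1 = global_map G N f c2"
    and X: "finite X" "X \<subseteq> carrier G" and off: "\<And>x. x \<in> carrier G \<Longrightarrow> x \<notin> X \<Longrightarrow> c1 x = c2 x"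
  shows "c1 = c2"
proof (rule ccontr)
  assume "c1 \<noteq> c2"
  define E where "E = X \<union> (thickening G N X <#> N)"
  have th: "finite (thickening G N X)" "thickening G N X \<subseteq> carrier G"
    using finite_thickening[OF finite_neighborhood X(1)] thickening_eq[OF neighborhood_subset X(2)] by auto
  have "thickening G N X <#> N = (\<lambda>(a, b). a \<otimes> b) ` (thickening G N X \<times> N)"
    by (auto simp: set_mult_def)
  then have E: "finite E"
    using X th finite_neighborhood by (simp add: E_def)
  have "E \<subseteq> carrier G"
    unfolding E_def using X th neighborhood_subset by (intro Un_least set_mult_closed)
  note E = E this
  have "mutually_erasable G Q N f E (restrict c1 E) (restrict c2 E)"
    unfolding mutually_erasable_def
  proof (intro ballI impI, elim conjE)
    fix d1 d2 assume d: "d1 \<in> configs G Q" "d2 \<in> configs G Q"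
      and d1: "restrict d1 E = restrict c1 E" and d2: "restrict d2 E = restrict c2 E"
      and d12: "restrict d1 (carrier G - E) = restrict d2 (carrier G - E)"
    have d1E: "d1 x = c1 x" and d2E: "d2 x = c2 x" if "x \<in> E" for x
      using fun_cong[OF d1, of x] fun_cong[OF d2, of x] that by simp_all
    have dX: "d1 x = d2 x" if "x \<in> carrier G" "x \<notin> X" for x
      using fun_cong[OF d12, of x] d1E d2E off that by (cases "x \<in> E") simp_all
    show "global_map G N f d1 = global_map G N f d2"
    proof (rule PiE_ext[OF global_map_in_configs[OF d(1)] global_map_in_configs[OF d(2)]])
      fix g assume g: "g \<in> carrier G"
      have gN: "g <# N \<subseteq> carrier G" using g neighborhood_subset by (auto simp: l_coset_def)
      show "global_map G N f d1 g = global_map G N f d2 g"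
      proof (cases "g \<in> thickening G N X")
        case True
        then have "g <# N \<subseteq> E" by (auto simp: E_def l_coset_def set_mult_def)
        then have "global_map G N f d1 g = global_map G N f c1 g"
          "global_map G N f d2 g = global_map G N f c2 g"
          using g d1E d2E by (auto intro!: global_map_local)
        with eq show ?thesis by simp
      next
        case False
        then have "(g <# N) \<inter> X = {}" using g thickening_eq[OF neighborhood_subset X(2)] by blast
        then show ?thesis using g gN dX by (intro global_map_local) blast+
      qed
    qed
  qed
  moreover have "restrict c1 E \<noteq> restrict c2 E"
  proof
    assume r: "restrict c1 E = restrict c2 E"
    have "c1 x = c2 x" if "x \<in> carrier G" for x
      using fun_cong[OF r, of x] off[OF that] by (cases "x \<in> X") (auto simp: E_def)
    with c \<open>c1 \<noteq> c2\<close> show False by (meson PiE_ext)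
  qed
  moreover have "restrict c1 E \<in> E \<rightarrow>\<^sub>E Q" "restrict c2 E \<in> E \<rightarrow>\<^sub>E Q" using c E by auto
  ultimately show False using pre E unfolding preinjective_def by blast
qed

text \<open>
  The patterns on the Foelner set \<open>Z\<close>, extended by a constant, have images that are determined by
  their restriction to \<open>Y\<close>, which is \<open>Z\<close> with its boundary. All these images avoid the orphan on
  each translate inside \<open>Z\<close>. As the translates are numerous and the boundary is small, there are
  fewer images than patterns on \<open>Z\<close>.
\<close>

theorem preinjective_imp_surjective:
  assumes X: "amenable_seq G X" and pre: "preinjective G Q N f"
  shows "ca_surjective G Q N f"
proof (rule ccontr)
  assume "\<not> ca_surjective G Q N f"
  moreover have "exhaustive_seq G X" using X unfolding amenable_seq_def by blast
  ultimately obtain E p where E: "finite E" "E \<noteq> {}" "E \<subseteq> carrier G" and "orphan E p"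
    using ex_orphan by blast
  then have p: "p \<in> E \<rightarrow>\<^sub>E Q" and orphan: "\<And>c m. c \<in> configs G Q \<Longrightarrow> m \<in> carrier G \<Longrightarrow>
       restrict (translate G m (global_map G N f c)) E \<noteq> p"
    by (auto simp: orphan_def)
  obtain M where sat: "saturated_packing E M" using ex_saturated_packing[OF E(2)] .
  then have M: "M \<subseteq> carrier G" "disjoint_family_on (\<lambda>m. m <# E) M"
    by (simp_all add: saturated_packing_def)
  obtain \<delta> :: real where \<delta>: "0 < \<delta>" and dens: "\<forall>\<^sub>F n in sequentially. 0 < card (X n) \<and>
       \<delta> * real (card (X n)) \<le> real (card {m \<in> M. m <# E \<subseteq> X n})"
    using saturated_packing_density[OF X E sat] by blast
  obtain s where s: "\<forall>t b x y. s * b < t \<and> y \<le> x + b \<and> t * card E \<le> y \<longrightarrow>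
      (card Q ^ card E - 1) ^ t * card Q ^ (y - t * card E) < card Q ^ x"
    using avoiding_bound_lt[OF two_states] by blast
  \<comment> \<open>Using \<open>s + 1\<close> in place of \<open>s\<close> covers the case \<open>s = 0\<close>.\<close>
  have "0 < \<delta> / (real s + 1)" using \<delta> by simp
  from eventually_conj[OF dens amenable_boundary_small[OF X finite_neighborhood
        neighborhood_nonempty neighborhood_subset this]]
  obtain n where n: "0 < card (X n)"
      "\<delta> * real (card (X n)) \<le> real (card {m \<in> M. m <# E \<subseteq> X n})"
      "real (card (boundary G N (X n))) < \<delta> / (real s + 1) * real (card (X n))"
    by (auto simp: eventually_sequentially)
  define Z where "Z = X n"
  define T where "T = {m \<in> M. m <# E \<subseteq> Z}"
  define Y where "Y = Z \<union> boundary G N Z"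
  have Z: "finite Z" "Z \<subseteq> carrier G"
    using X unfolding Z_def amenable_seq_def exhaustive_seq_def by blast+
  have bfin: "finite (boundary G N Z)" "boundary G N Z \<subseteq> carrier G"
    using finite_thickening[OF finite_neighborhood Z(1)] thickening_eq[OF neighborhood_subset Z(2)]
    by (auto simp: boundary_def)
  have Y: "finite Y" "Y \<subseteq> carrier G" "Z \<subseteq> Y" "card Y \<le> card Z + card (boundary G N Z)"
    using Z bfin by (auto simp: Y_def card_Un_le)
  have T: "finite T" "T \<subseteq> M"
    using finite_tiles_inside[OF M(1) Z(1) E(2,3)] by (auto simp: T_def)
  have "real s * real (card (boundary G N Z)) \<le> (real s + 1) * real (card (boundary G N Z))"
    by (simp add: algebra_simps)
  also have "\<dots> < \<delta> * real (card Z)" using n(3) by (simp add: Z_def field_simps)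
  also have "\<dots> \<le> real (card T)" using n(2) by (simp add: Z_def T_def)
  finally have sb: "s * card (boundary G N Z) < card T"
    by (metis of_nat_less_iff of_nat_mult)

  define w where "w m = (\<lambda>x\<in>(m <# E). p (inv m \<otimes> x))" for m
  let ?B = "{u \<in> Y \<rightarrow>\<^sub>E Q. \<forall>m\<in>T. restrict u (m <# E) \<noteq> w m}"
  have tile: "m <# E \<subseteq> Y" "card (m <# E) = card E" "w m \<in> (m <# E) \<rightarrow>\<^sub>E Q" if m: "m \<in> T" for m
  proof -
    show "m <# E \<subseteq> Y" using m Y by (auto simp: T_def)
    have mc: "m \<in> carrier G" using m T M by blast
    have "m <# E = (\<lambda>x. m \<otimes> x) ` E" by (auto simp: l_coset_def)
    then show "card (m <# E) = card E"
      using mc E by (simp add: card_image inj_on_def subset_iff)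
    show "w m \<in> (m <# E) \<rightarrow>\<^sub>E Q"
      using p mc E by (auto simp: w_def l_coset_def m_assoc[symmetric] subset_iff)
  qed
  have disjT: "disjoint_family_on (\<lambda>m. m <# E) T"
    using M(2) T disjoint_family_on_mono by blast
  note bound = card_functions_avoiding_patterns[OF Y(1) finite_states T(1) tile(1) disjT tile(2,3)]
  have "card ?B \<le> (card Q ^ card E - 1) ^ card T * card Q ^ (card Y - card T * card E)"
    by (rule bound(1))
  also have "\<dots> < card Q ^ card Z"
    using s sb Y(4) bound(2) by blast
  also have "\<dots> = card (Z \<rightarrow>\<^sub>E Q)" using Z by (simp add: card_PiE)
  finally have less: "card ?B < card (Z \<rightarrow>\<^sub>E Q)" .

  obtain q where "q \<in> Q" using states_nonempty by blast
  define ext where "ext u = (\<lambda>x\<in>carrier G. if x \<in> Z then u x else q)" for u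
  have ext: "ext u \<in> configs G Q" if "u \<in> Z \<rightarrow>\<^sub>E Q" for u
    using that \<open>q \<in> Q\<close> by (auto simp: ext_def)
  let ?h = "\<lambda>u. restrict (global_map G N f (ext u)) Y"
  have "?h u \<in> ?B" if u: "u \<in> Z \<rightarrow>\<^sub>E Q" for u
  proof -
    have "?h u \<in> Y \<rightarrow>\<^sub>E Q" using global_map_in_configs[OF ext[OF u]] Y by auto
    moreover have "restrict (?h u) (m <# E) \<noteq> w m" if m: "m \<in> T" for m
    proof
      assume eq: "restrict (?h u) (m <# E) = w m"
      have mc: "m \<in> carrier G" using m T M by blast
      have "global_map G N f (ext u) (m \<otimes> e) = p e" if e: "e \<in> E" for e
      proof -
        have me: "m \<otimes> e \<in> m <# E" using e by (auto simp: l_coset_def)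
        then have "m \<otimes> e \<in> Y" using tile(1)[OF m] by blast
        then show ?thesis
          using fun_cong[OF eq, of "m \<otimes> e"] me mc e E by (auto simp: w_def m_assoc[symmetric] subset_iff)
      qed
      moreover have "e \<in> carrier G" if "e \<in> E" for e using that E by blast
      ultimately have "restrict (translate G m (global_map G N f (ext u))) E x = p x" for x
        using p by (cases "x \<in> E") (auto simp: translate_def)
      then have "restrict (translate G m (global_map G N f (ext u))) E = p" ..
      with orphan[OF ext[OF u] mc] show False by blast
    qed
    ultimately show ?thesis by blast
  qed
  then have "?h ` (Z \<rightarrow>\<^sub>E Q) \<subseteq> ?B" by blast
  moreover have "finite ?B" using finite_PiE[OF Y(1), of "\<lambda>_. Q"] finite_states by simp
  ultimately have "\<not> inj_on ?h (Z \<rightarrow>\<^sub>E Q)"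
    using less card_inj_on_le[of ?h "Z \<rightarrow>\<^sub>E Q" ?B] by linarith
  then obtain u v where u: "u \<in> Z \<rightarrow>\<^sub>E Q" and v: "v \<in> Z \<rightarrow>\<^sub>E Q" and "u \<noteq> v" and huv: "?h u = ?h v"
    unfolding inj_on_def by blast
  have "global_map G N f (ext u) = global_map G N f (ext v)"
  proof (rule PiE_ext[OF global_map_in_configs[OF ext[OF u]] global_map_in_configs[OF ext[OF v]]])
    fix g assume g: "g \<in> carrier G"
    show "global_map G N f (ext u) g = global_map G N f (ext v) g"
    proof (cases "g \<in> Y")
      case True
      then show ?thesis using fun_cong[OF huv, of g] by simp
    next
      case False
      then have "(g <# N) \<inter> Z = {}"
        using g thickening_eq[OF neighborhood_subset Z(2)] by (auto simp: Y_def boundary_def)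
      then show ?thesis using g by (intro global_map_local) (auto simp: ext_def restrict_def)
    qed
  qed
  then have "ext u = ext v"
    by (rule preinjective_finite_difference[OF pre ext[OF u] ext[OF v] _ Z]) (auto simp: ext_def)
  have "u = v"
  proof (rule PiE_ext[OF u v])
    fix x assume "x \<in> Z"
    then show "u x = v x" using fun_cong[OF \<open>ext u = ext v\<close>, of x] Z by (auto simp: ext_def)
  qed
  with \<open>u \<noteq> v\<close> show False by blast
qed

end

lemma surjective_imp_besicovitch_surjective:
  assumes "ca_surjective G Q N f"
  shows "besicovitch_surjective G Q X (global_map G N f)"
  unfolding besicovitch_surjective_def
proof
  fix c assume "c \<in> configs G Q"
  then obtain c' where "c' \<in> configs G Q" "c = global_map G N f c'"
    using assms unfolding ca_surjective_def by blast
  then show "\<exists>c'\<in>configs G Q. besicovitch_dist X c (global_map G N f c') = 0"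
    using besicovitch_dist_self by blast
qed

section \<open>Relations between Besicovitch and classical properties\<close>

theorem theorem3p11:
  fixes G :: "('g, 'm) monoid_scheme" and X :: "nat \<Rightarrow> 'g set"
    and Q :: "'q set" and N :: "'g set" and f :: "('g \<Rightarrow> 'q) \<Rightarrow> 'q"
  assumes "group G" and "infinite (carrier G)" and "finitely_generated G"
    and "exhaustive_seq G X" and "contains_amenable_subseq G X"
    and "cellular_automaton G Q N f"
  shows "(besicovitch_surjective G Q X (global_map G N f) \<longrightarrow> ca_surjective G Q N f) \<and>
         (besicovitch_injective G Q X (global_map G N f) \<longrightarrow> preinjective G Q N f) \<and>
         (besicovitch_injective G Q X (global_map G N f) \<longrightarrow>
            besicovitch_surjective G Q X (global_map G N f))"
proof -
  interpret cellular_automaton G Q N f by fact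
  obtain r where r: "strict_mono r" and X: "amenable_seq G (X \<circ> r)"
    using \<open>contains_amenable_subseq G X\<close> unfolding contains_amenable_subseq_def by blast
  show ?thesis
    using besicovitch_surjective_imp_surjective[OF r X]
      besicovitch_injective_imp_preinjective[OF r X]
      preinjective_imp_surjective[OF X] surjective_imp_besicovitch_surjective
    by blast
qed

end
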